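(* Let $\mathbb{F}$ be a field with characteristic $p$ (with the convention $p=\infty$ if the identity has infinite additive order), and let $P(x)\in\mathbb{F}[x]$. Suppose that there exist nonnegative integers $k<l$ such that $\hat P(i)=0$ for all integers $i$ with $k<i<l$. Then either $x^l\mid P(x)$, or $\deg P(x)\le k$, or $N_q(P)\ge l-k$ for some $q\in\mathcal{P}(p)$.
   Context: The characteristic of a field $\mathbb{F}$ is defined here as the additive order of its multiplicative identity; it is either a prime or $\infty$ (so $p=\infty$ corresponds to what is usually called characteristic $0$). Set $\mathcal{P}(p)=\{1,p,p^2,\ldots\}$ if $p<\infty$, and $\mathcal{P}(p)=\{1\}$ if $p=\infty$. For a polynomial $P(x)$, $\hat P(i)$ denotes the coefficient of $x^i$ in $P(x)$. Let $\mathbb{E}$ be the algebraic closure of $\mathbb{F}$ and $\mathbb{E}^{\times}=\mathbb{E}\setminus\{0\}$; view $P(x)$ as a polynomial over $\mathbb{E}$. For $\alpha\in\mathbb{E}$, $m_P(\alpha)$ denotes the multiplicity of $\alpha$ with respect to $P$, i.e. the integer $m\ge 0$ such that $(x-\alpha)^m\mid P(x)$ but $(x-\alpha)^{m+1}\nmid P(x)$ (so $m_P(\alpha)=0$ if $\alpha$ is not a root). For a positive integer $q$ define $$N_q(P)=q\,|\{\alpha\in\mathbb{E}^{\times}: m_P(\alpha)\ge q\}|-\sum_{\alpha\in\mathbb{E}^{\times}}\{m_P(\alpha)\}_q,$$ where $\{m\}_q$ denotes the least nonnegative residue of $m$ modulo $q$. (These quantities are used for nonzero $P$; the zero polynomial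 is divisible by $x^l$.) *)

theory Defs
  imports "HOL-Algebra.Algebraic_Closure_Type"
begin

text \<open>
  An infinite additive order of the identity corresponds to \<open>CHAR('a) = 0\<close> in the library,
  so \<open>p = 0\<close> plays the role of \<open>p = \<infinity>\<close> here.
\<close>

definition char_powers :: "nat \<Rightarrow> nat set" where
  "char_powers p = (if p = 0 then {1} else range (\<lambda>n. p ^ n))"

definition root_mult :: "'a::field poly \<Rightarrow> 'a alg_closure \<Rightarrow> nat" where
  "root_mult P \<alpha> = Polynomial.order \<alpha> (map_poly to_ac P)"

text \<open>
  The sum over all nonzero \<open>\<alpha>\<close> is written as a sum over the nonzero roots, since
  \<open>\<Sum>\<close> over an infinite set is \<open>0\<close> by convention; the omitted summands are \<open>0 mod q = 0\<close>.
  Only meaningful for \<open>P \<noteq> 0\<close> and \<open>q > 0\<close>.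
\<close>

definition N :: "nat \<Rightarrow> 'a::field poly \<Rightarrow> int" where
  "N q P =
     int q * int (card {\<alpha>::'a alg_closure. \<alpha> \<noteq> 0 \<and> root_mult P \<alpha> \<ge> q})
     - int (\<Sum>\<alpha> | \<alpha> \<noteq> 0 \<and> poly (map_poly to_ac P) \<alpha> = 0. root_mult P \<alpha> mod q)"

end

theory Submission
  imports Defs
begin

text \<open>
  Work over the algebraic closure \<open>E\<close> of the coefficient field. If \<open>x^l\<close> does not divide \<open>P\<close>
  and \<open>deg P > k\<close>, the gap splits \<open>P\<close> into two nonzero parts, \<open>P = A + B\<close> with \<open>deg A \<le> k\<close> and
  \<open>x^l dvd B\<close>. To such a three-term relation one applies the argument of the Mason--Stothers
  theorem: the Wronskian \<open>A B' - A' B = A P' - A' P\<close> is divisible by \<open>x^(l - 1)\<close> and by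
  \<open>(x - \<alpha>)^(m - 1)\<close> for every root \<open>\<alpha>\<close> of \<open>P\<close> of multiplicity \<open>m\<close>, but its degree is less than
  \<open>deg A + deg P\<close>. If \<open>P(0) \<noteq> 0\<close> and the Wronskian does not vanish, this already gives at least
  \<open>l - k\<close> distinct roots, which is the claim for \<open>q = 1\<close>.

  In positive characteristic the Wronskian may vanish, and this is where the larger \<open>q\<close> come from.
  Write \<open>A = C F\<close> and \<open>B = C G\<close> with \<open>F\<close>, \<open>G\<close> coprime. A vanishing Wronskian of coprime
  polynomials forces \<open>F' = G' = 0\<close>, and since \<open>E\<close> is perfect, \<open>F\<close> and \<open>G\<close> are then \<open>p\<close>-th powers.
  Taking \<open>p\<close>-th roots as long as the Wronskian vanishes gives \<open>F = F\<^sub>1^q\<close>, \<open>G = G\<^sub>1^q\<close>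
  with \<open>F\<^sub>1\<close>, \<open>G\<^sub>1\<close> of nonzero Wronskian (\<open>coprime_pair_as_powers\<close>). The Frobenius map is additive,
  so \<open>P = C H^q\<close> with \<open>H = F\<^sub>1 + G\<^sub>1\<close>.

  The number \<open>n\<close> of distinct roots of \<open>H\<close> is at least \<open>ord\<^sub>0 G\<^sub>1 - deg F\<^sub>1\<close> (\<open>card_roots_add_ge\<close>).
  Multiplying by \<open>q\<close> gives \<open>q n \<ge> (l - ord\<^sub>0 C) - (k - deg C)\<close>. Every root of \<open>H\<close> is nonzero and
  has multiplicity at least \<open>q\<close> in \<open>P\<close>, while modulo \<open>q\<close> the multiplicities of \<open>P\<close> agree with those
  of \<open>C\<close>, whose sum over nonzero points is at most \<open>deg C - ord\<^sub>0 C\<close>. Thus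
  \<open>N\<^sub>q(P) \<ge> q n - (deg C - ord\<^sub>0 C) \<ge> l - k\<close> (\<open>N_ge_of_power_factor\<close>).
\<close>

section \<open>Orders of vanishing and derivatives\<close>

text \<open>
  Allowing sets \<open>S\<close> that contain non-roots makes it possible to count the point \<open>0\<close> alongside the
  roots of some other polynomial.
\<close>

lemma sum_order_le_degree_finite:
  fixes p :: "'a::field poly"
  assumes "p \<noteq> 0" "finite S"
  shows "(\<Sum>x\<in>S. Polynomial.order x p) \<le> Polynomial.degree p"
proof -
  have fin: "finite {x. poly p x = 0}"
    using assms(1) by (rule poly_roots_finite)
  have "(\<Sum>x\<in>S. Polynomial.order x p) = (\<Sum>x\<in>S \<inter> {x. poly p x = 0}. Polynomial.order x p)"
    by (rule sum.mono_neutral_right) (use assms in \<open>auto simp: order_root\<close>)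
  also have "\<dots> \<le> (\<Sum>x | poly p x = 0. Polynomial.order x p)"
    by (rule sum_mono2) (use fin in auto)
  also have "\<dots> \<le> Polynomial.degree p"
    by (rule sum_order_le_degree) fact
  finally show ?thesis .
qed

lemma sum_order_eq_degree:
  fixes p :: "'a::alg_closed_field poly"
  assumes "p \<noteq> 0"
  shows "(\<Sum>x | poly p x = 0. Polynomial.order x p) = Polynomial.degree p"
  using assms
proof (induction p rule: poly_root_order_induct)
  case 0
  then show ?case by simp
next
  case (no_roots p)
  then have "Polynomial.degree p = 0"
    using alg_closed_imp_poly_has_root[of p] by auto
  with no_roots show ?case by simp
next
  case (root p x n)
  let ?q = "[:-x, 1:] ^ n * p"
  have p: "p \<noteq> 0"
    using root.hyps by auto
  have fin: "finite {y. poly p y = 0}"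
    using p by (rule poly_roots_finite)
  have roots: "{y. poly ?q y = 0} = insert x {y. poly p y = 0}"
    using root.hyps by auto
  have ord: "Polynomial.order y ?q = (if y = x then n else 0) + Polynomial.order y p" for y
    using p by (auto simp: order_mult order_power_n_n intro!: order_0I)
  have "(\<Sum>y | poly ?q y = 0. Polynomial.order y ?q)
      = Polynomial.order x ?q + (\<Sum>y | poly p y = 0. Polynomial.order y ?q)"
    unfolding roots using fin root.hyps by simp
  also have "Polynomial.order x ?q = n"
    using root.hyps by (simp add: ord order_0I)
  also have "(\<Sum>y | poly p y = 0. Polynomial.order y ?q) = (\<Sum>y | poly p y = 0. Polynomial.order y p)"
    by (rule sum.cong) (use root.hyps in \<open>auto simp: ord\<close>)
  also have "\<dots> = Polynomial.degree p"
    using root.IH p by blast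
  also have "n + Polynomial.degree p = Polynomial.degree ?q"
    using p by (simp add: degree_mult_eq degree_linear_power)
  finally show ?case .
qed

lemma order_power:
  fixes p :: "'a::field poly"
  assumes "p \<noteq> 0"
  shows "Polynomial.order x (p ^ n) = n * Polynomial.order x p"
  by (induction n) (use assms in \<open>auto simp: order_mult\<close>)

text \<open>
  Only this divisibility survives in positive characteristic: the derivative may vanish to higher
  order, or identically, when the multiplicity is a multiple of the characteristic.
\<close>

lemma linear_power_dvd_pderiv:
  fixes p :: "'a::field poly"
  assumes "[:-x, 1:] ^ n dvd p"
  shows "[:-x, 1:] ^ (n - 1) dvd pderiv p"
proof (cases n)
  case (Suc m)
  let ?t = "[:-x, 1:]"
  obtain r where r: "p = ?t ^ Suc m * r"
    using assms unfolding Suc by (elim dvdE)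
  have eq: "pderiv p = ?t ^ Suc m * pderiv r + r * (Polynomial.smult (of_nat (Suc m)) (?t ^ m) * pderiv ?t)"
    unfolding r by (simp only: pderiv_mult pderiv_power_Suc)
  have "?t ^ m dvd ?t ^ Suc m"
    by (rule le_imp_power_dvd) (rule le_SucI, rule order.refl)
  moreover have "?t ^ m dvd Polynomial.smult (of_nat (Suc m)) (?t ^ m)"
    by (rule dvd_smult) (rule dvd_refl)
  ultimately have "?t ^ m dvd pderiv p"
    unfolding eq by (blast intro: dvd_add dvd_mult dvd_mult2)
  then show ?thesis
    unfolding Suc by simp
qed simp

lemma degree_pderiv_le_diff:
  fixes p :: "'a::field poly"
  shows "Polynomial.degree (pderiv p) \<le> Polynomial.degree p - 1"
  by (rule Polynomial.degree_le) (auto simp: coeff_pderiv coeff_eq_0)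

lemma order_wronskian_ge:
  fixes p r :: "'a::field poly"
  assumes "p * pderiv r - pderiv p * r \<noteq> 0"
  shows "Polynomial.order x r - 1 \<le> Polynomial.order x (p * pderiv r - pderiv p * r)"
proof -
  have "[:-x, 1:] ^ (Polynomial.order x r - 1) dvd r"
    by (rule dvd_trans[OF le_imp_power_dvd order_1]) (rule diff_le_self)
  moreover have "[:-x, 1:] ^ (Polynomial.order x r - 1) dvd pderiv r"
    by (rule linear_power_dvd_pderiv) (rule order_1)
  ultimately have "[:-x, 1:] ^ (Polynomial.order x r - 1) dvd p * pderiv r - pderiv p * r"
    by (intro dvd_diff dvd_mult)
  then show ?thesis
    using assms order_divides by blast
qed

section \<open>A Mason--Stothers inequality\<close>

text \<open>
  The Wronskian \<open>W\<close> of \<open>F\<close> and \<open>G\<close> is also the Wronskian of \<open>F\<close> and \<open>H = F + G\<close>, so it inherits the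
  zeros of both \<open>G\<close> and \<open>H\<close>, each with multiplicity lowered by at most one. Counting at \<open>0\<close> for \<open>G\<close>
  and at the roots of \<open>H\<close>, which are all different from \<open>0\<close>, gives at least
  \<open>(ord\<^sub>0 G - 1) + (deg H - n)\<close> zeros, \<open>n\<close> being the number of distinct roots of \<open>H\<close>, whereas
  \<open>deg W \<le> deg F + deg H - 1\<close>.
\<close>

lemma card_roots_add_ge:
  fixes F G :: "'a::alg_closed_field poly"
  assumes W: "F * pderiv G - pderiv F * G \<noteq> 0"
    and F0: "poly F 0 \<noteq> 0"
    and lt: "Polynomial.degree F < Polynomial.order 0 G"
  shows "Polynomial.order 0 G \<le> Polynomial.degree F + card {x. poly (F + G) x = 0}"
proof -
  define H where "H = F + G"
  define W where "W = F * pderiv G - pderiv F * G"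
  define R where "R = {x. poly H x = 0}"
  have W_H: "W = F * pderiv H - pderiv F * H"
    by (simp add: W_def H_def pderiv_add algebra_simps)
  have [simp]: "W \<noteq> 0" using W by (simp add: W_def)
  have "G \<noteq> 0" using W by auto
  have "H \<noteq> 0" using W_H \<open>W \<noteq> 0\<close> by auto
  have degG: "Polynomial.degree F < Polynomial.degree G"
    using lt order_degree[OF \<open>G \<noteq> 0\<close>, of 0] by simp
  then have degH: "Polynomial.degree H = Polynomial.degree G"
    by (simp add: H_def degree_add_eq_right)
  have finR: "finite R"
    unfolding R_def using \<open>H \<noteq> 0\<close> by (rule poly_roots_finite)
  have "poly G 0 = 0"
    using lt by (simp add: order_root)
  then have "0 \<notin> R"
    using F0 by (simp add: R_def H_def)

  have degW: "Polynomial.degree W \<le> Polynomial.degree F + Polynomial.degree H - 1"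
  proof -
    have "Polynomial.degree (F * pderiv H) \<le> Polynomial.degree F + Polynomial.degree H - 1"
      using degree_mult_le[of F "pderiv H"] degree_pderiv_le_diff[of H] degG degH by linarith
    moreover have "Polynomial.degree (pderiv F * H) \<le> Polynomial.degree F + Polynomial.degree H - 1"
    \<comment> \<open>A constant \<open>F\<close> has to be treated apart, since \<open>degree F - 1\<close> is then truncated.\<close>
    proof (cases "Polynomial.degree F = 0")
      case True
      then have "pderiv F = 0" by (auto elim!: degree_eq_zeroE simp: pderiv_pCons)
      then show ?thesis by simp
    next
      case False
      then show ?thesis
        using degree_mult_le[of "pderiv F" H] degree_pderiv_le_diff[of F] by linarith
    qed
    ultimately show ?thesis
      unfolding W_H by (rule degree_diff_le)
  qed

  have ord0: "Polynomial.order 0 G - 1 \<le> Polynomial.order 0 W"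
    unfolding W_def by (rule order_wronskian_ge) (rule W)
  have "F * pderiv H - pderiv F * H \<noteq> 0"
    using \<open>W \<noteq> 0\<close> unfolding W_H .
  then have ordR: "Polynomial.order x H - 1 \<le> Polynomial.order x W" for x
    unfolding W_H by (rule order_wronskian_ge)

  have "(\<Sum>x\<in>R. Polynomial.order x H) = (\<Sum>x\<in>R. (Polynomial.order x H - 1) + 1)"
    by (rule sum.cong) (use \<open>H \<noteq> 0\<close> in \<open>auto simp: R_def order_root\<close>)
  also have "\<dots> = (\<Sum>x\<in>R. Polynomial.order x H - 1) + card R"
    by (simp only: sum.distrib card_eq_sum)
  finally have "Polynomial.degree H = (\<Sum>x\<in>R. Polynomial.order x H - 1) + card R"
    unfolding R_def using sum_order_eq_degree[OF \<open>H \<noteq> 0\<close>] by simp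
  moreover have "(\<Sum>x\<in>R. Polynomial.order x H - 1) \<le> (\<Sum>x\<in>R. Polynomial.order x W)"
    by (rule sum_mono) (rule ordR)
  moreover have "Polynomial.order 0 W + (\<Sum>x\<in>R. Polynomial.order x W) \<le> Polynomial.degree W"
    using sum_order_le_degree_finite[of W "insert 0 R"] finR \<open>0 \<notin> R\<close> by simp
  ultimately have "Polynomial.order 0 G \<le> Polynomial.degree F + card R"
    using ord0 degW lt degG degH by linarith
  then show ?thesis
    by (simp add: R_def H_def)
qed

section \<open>Extracting Frobenius roots\<close>

text \<open>
  A zero derivative leaves only the coefficients at multiples of the characteristic. Taking roots of
  these, which exist over an algebraically closed field, gives the coefficients of \<open>F1\<close>, because
  the Frobenius map is additive.
\<close>

lemma pderiv_zero_imp_CHAR_power: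
  fixes F :: "'a::alg_closed_field poly"
  assumes "pderiv F = 0" and pos: "CHAR('a) > 0"
  shows "\<exists>F1. F = F1 ^ CHAR('a)"
proof -
  let ?p = "CHAR('a)"
  have "prime ?p"
    using pos by (rule prime_CHAR_semidom)
  define r where "r j = (SOME y. y ^ ?p = Polynomial.coeff F (j * ?p))" for j
  have r: "r j ^ ?p = Polynomial.coeff F (j * ?p)" for j
    unfolding r_def by (rule someI_ex) (rule nth_root_exists[OF pos])
  have coeff0: "Polynomial.coeff F i = 0" if ndvd: "\<not> ?p dvd i" for i
  proof -
    obtain j where j: "i = Suc j"
      using ndvd by (cases i) auto
    have "of_nat i * Polynomial.coeff F i = Polynomial.coeff (pderiv F) j"
      by (simp add: coeff_pderiv j del: of_nat_Suc)
    then show ?thesis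
      using ndvd assms(1) by (simp add: of_nat_eq_0_iff_char_dvd)
  qed
  define F1 where "F1 = (\<Sum>j\<le>Polynomial.degree F. Polynomial.monom (r j) j)"
  have "F1 ^ ?p = (\<Sum>j\<le>Polynomial.degree F. Polynomial.monom (r j) j ^ ?p)"
    unfolding F1_def by (rule freshmans_dream_sum) (use \<open>prime ?p\<close> in auto)
  also have "\<dots> = (\<Sum>j\<le>Polynomial.degree F. Polynomial.monom (Polynomial.coeff F (j * ?p)) (j * ?p))"
    by (simp add: monom_power r mult.commute)
  also have "\<dots> = F"
  proof (rule poly_eqI)
    fix i
    have "Polynomial.coeff (\<Sum>j\<le>Polynomial.degree F. Polynomial.monom (Polynomial.coeff F (j * ?p)) (j * ?p)) i
        = (\<Sum>j\<le>Polynomial.degree F. if j * ?p = i then Polynomial.coeff F i else 0)"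
      by (auto simp: Polynomial.coeff_sum intro!: sum.cong)
    also have "\<dots> = Polynomial.coeff F i"
    proof (cases "?p dvd i \<and> i \<le> Polynomial.degree F")
      case True
      then obtain j where j: "i = j * ?p"
        by (metis dvdE mult.commute)
      have "j \<le> i" using j pos by simp
      moreover have "j' * ?p = i \<longleftrightarrow> j' = j" for j'
        using j pos by simp
      ultimately show ?thesis
        using True by simp
    next
      case False
      then have "Polynomial.coeff F i = 0"
        using coeff0 coeff_eq_0 by (meson not_le)
      then show ?thesis by (intro trans[OF sum.neutral]) auto
    qed
    finally show "Polynomial.coeff (\<Sum>j\<le>Polynomial.degree F. Polynomial.monom (Polynomial.coeff F (j * ?p)) (j * ?p)) i
        = Polynomial.coeff F i" .
  qed
  finally show ?thesis by metis
qed

lemma one_in_char_powers: "1 \<in> char_powers p"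
  unfolding char_powers_def using range_eqI[of 1 "\<lambda>n. p ^ n" 0] by auto

lemma char_powers_pos: "q \<in> char_powers p \<Longrightarrow> q > 0"
  by (auto simp: char_powers_def split: if_splits)

lemma add_power_char_powers:
  fixes F G :: "'a::field poly"
  assumes "q \<in> char_powers CHAR('a)"
  shows "(F + G) ^ q = F ^ q + G ^ q"
proof (cases "CHAR('a) = 0")
  case True
  then show ?thesis
    using assms by (simp add: char_powers_def)
next
  case False
  then have "prime CHAR('a)"
    using prime_CHAR_semidom by blast
  moreover obtain n where "q = CHAR('a) ^ n"
    using assms False by (auto simp: char_powers_def)
  ultimately show ?thesis
    using freshmans_dream'[of q n F G] by simp
qed

lemma mult_in_char_powers:
  assumes "p > 0" "q \<in> char_powers p"
  shows "q * p \<in> char_powers p"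
  using assms range_eqI[of _ "\<lambda>n. p ^ n" "Suc _"] by (auto simp: char_powers_def mult.commute)

instance alg_closure :: (field) field_gcd ..

text \<open>
  If \<open>F G' = F' G\<close> then \<open>F\<close> divides \<open>F' G\<close>, hence \<open>F'\<close> by coprimality, and \<open>F'\<close> is too small in
  degree to be a nonzero multiple of \<open>F\<close>.
\<close>

lemma wronskian_zero_coprime:
  fixes F G :: "'a::field_gcd poly"
  assumes "coprime F G" "F * pderiv G - pderiv F * G = 0"
  shows "pderiv F = 0"
proof (rule ccontr)
  assume nz: "pderiv F \<noteq> 0"
  have "F dvd pderiv F * G"
    using assms(2) by (metis dvd_triv_left eq_iff_diff_eq_0)
  then have "F dvd pderiv F"
    using assms(1) by (simp add: coprime_dvd_mult_left_iff)
  then have "Polynomial.degree F \<le> Polynomial.degree F - 1"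
    using nz dvd_imp_degree_le degree_pderiv_le_diff order.trans by blast
  then have "Polynomial.degree F = 0" by simp
  then show False
    using nz by (auto elim!: degree_eq_zeroE simp: pderiv_pCons)
qed

text \<open>
  While the Wronskian vanishes, both polynomials are \<open>p\<close>-th powers of polynomials that are again
  coprime. Replacing them by their \<open>p\<close>-th roots divides the degree of \<open>G\<close> by \<open>p\<close>, so this has to
  end; in characteristic \<open>0\<close> it never starts, because \<open>G' = 0\<close> is impossible for nonconstant \<open>G\<close>.
\<close>

lemma coprime_pair_as_powers:
  fixes F G :: "'a::{alg_closed_field, field_gcd} poly"
  assumes "coprime F G" "Polynomial.degree G > 0"
  shows "\<exists>q \<in> char_powers CHAR('a). \<exists>F1 G1. F = F1 ^ q \<and> G = G1 ^ q \<and>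
           F1 * pderiv G1 - pderiv F1 * G1 \<noteq> 0"
  using assms
proof (induction "Polynomial.degree G" arbitrary: F G rule: less_induct)
  case less
  let ?p = "CHAR('a)"
  show ?case
  proof (cases "F * pderiv G - pderiv F * G = 0")
    case False
    then show ?thesis
      using one_in_char_powers by (metis power_one_right)
  next
    case True
    have F': "pderiv F = 0"
      using less.prems(1) True by (rule wronskian_zero_coprime)
    have G': "pderiv G = 0"
    proof (rule wronskian_zero_coprime)
      show "coprime G F" using less.prems(1) by (simp add: coprime_commute)
      show "G * pderiv F - pderiv G * F = 0" using True by (simp add: algebra_simps)
    qed
    have pos: "?p > 0"
    proof (rule ccontr)
      assume "\<not> ?p > 0"
      then have "of_nat (Polynomial.degree G) \<noteq> (0::'a)"
        using less.prems(2) by (simp add: of_nat_eq_0_iff_char_dvd)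
      moreover have "of_nat (Polynomial.degree G) * Polynomial.lead_coeff G = 0"
        using arg_cong[OF G', of "\<lambda>r. Polynomial.coeff r (Polynomial.degree G - 1)"] less.prems(2)
        by (simp add: coeff_pderiv del: of_nat_Suc)
      ultimately show False
        using less.prems(2) by auto
    qed
    have p1: "?p > 1"
      using prime_gt_1_nat prime_CHAR_semidom[OF pos] by blast
    obtain F1 where F1: "F = F1 ^ ?p"
      using pderiv_zero_imp_CHAR_power[OF F' pos] by blast
    obtain G1 where G1: "G = G1 ^ ?p"
      using pderiv_zero_imp_CHAR_power[OF G' pos] by blast
    have degG: "Polynomial.degree G = ?p * Polynomial.degree G1"
    proof -
      have "G1 \<noteq> 0" using less.prems(2) G1 pos by (auto simp: power_0_left)
      then show ?thesis unfolding G1 by (simp add: degree_power_eq)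
    qed
    have "Polynomial.degree G1 > 0"
      using degG less.prems(2) by simp
    moreover from this have "Polynomial.degree G1 < Polynomial.degree G"
      using degG p1 by simp
    moreover have "coprime F1 G1"
      using less.prems(1) pos unfolding F1 G1 by simp
    ultimately obtain q F2 G2 where q: "q \<in> char_powers ?p" "F1 = F2 ^ q" "G1 = G2 ^ q"
        "F2 * pderiv G2 - pderiv F2 * G2 \<noteq> 0"
      using less.hyps by metis
    have "F = F2 ^ (q * ?p)" "G = G2 ^ (q * ?p)"
      using F1 G1 q by (simp_all add: power_mult)
    then show ?thesis
      using q mult_in_char_powers[OF pos q(1)] by blast
  qed
qed

section \<open>From a power factor to the root statistic\<close>

text \<open>
  The multiplicity of \<open>\<alpha>\<close> in \<open>C H^q\<close> is \<open>c + q h\<close>, where \<open>c\<close> and \<open>h\<close> are the multiplicities in \<open>C\<close>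
  and \<open>H\<close>. It is at least \<open>q\<close> as soon as \<open>\<alpha>\<close> is a root of \<open>H\<close>, and its residue modulo \<open>q\<close> is at
  most \<open>c\<close>. The root \<open>0\<close> of \<open>C\<close> is not counted by \<open>N\<close>, which accounts for the term \<open>ord\<^sub>0 C\<close>.
\<close>

lemma N_ge_of_power_factor:
  fixes P :: "'a::field poly" and C H :: "'a alg_closure poly"
  assumes fact: "map_poly to_ac P = C * H ^ q" and q: "q > 0"
    and nz: "C \<noteq> 0" "H \<noteq> 0" and H0: "poly H 0 \<noteq> 0"
  shows "N q P \<ge> int q * int (card {x. poly H x = 0})
           + int (Polynomial.order 0 C) - int (Polynomial.degree C)"
proof -
  let ?P = "map_poly to_ac P :: 'a alg_closure poly"
  have P: "?P \<noteq> 0" using fact nz by simp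
  have mult: "root_mult P x = Polynomial.order x C + q * Polynomial.order x H" for x
    using nz by (simp add: root_mult_def fact order_mult order_power)
  define S where "S = {x::'a alg_closure. x \<noteq> 0 \<and> poly ?P x = 0}"
  have finS: "finite S"
    by (rule finite_subset[OF _ poly_roots_finite[OF P]]) (auto simp: S_def)
  have "(\<Sum>x\<in>S. root_mult P x mod q) \<le> (\<Sum>x\<in>S. Polynomial.order x C)"
    by (rule sum_mono) (simp add: mult)
  moreover have "Polynomial.order 0 C + (\<Sum>x\<in>S. Polynomial.order x C) \<le> Polynomial.degree C"
    using sum_order_le_degree_finite[OF nz(1), of "insert 0 S"] finS by (simp add: S_def)
  moreover have "card {x. poly H x = 0} \<le> card {x. x \<noteq> 0 \<and> root_mult P x \<ge> q}"
  proof (rule card_mono)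
    have "{x. x \<noteq> 0 \<and> root_mult P x \<ge> q} \<subseteq> S"
      using q by (auto simp: S_def root_mult_def order_root)
    then show "finite {x. x \<noteq> 0 \<and> root_mult P x \<ge> q}"
      using finS by (rule finite_subset)
    show "{x. poly H x = 0} \<subseteq> {x. x \<noteq> 0 \<and> root_mult P x \<ge> q}"
    proof safe
      fix x assume x: "poly H x = 0"
      then have "Polynomial.order x H \<ge> 1"
        using nz(2) by (simp add: order_root)
      then have "q * 1 \<le> q * Polynomial.order x H"
        by (rule mult_le_mono2)
      then show "q \<le> root_mult P x"
        unfolding mult by linarith
    qed (use H0 in auto)
  qed
  then have "int q * int (card {x. poly H x = 0})
      \<le> int q * int (card {x. x \<noteq> 0 \<and> root_mult P x \<ge> q})"
    by (intro mult_left_mono) auto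
  ultimately show ?thesis
    unfolding N_def S_def by linarith
qed

theorem lemma1:
  fixes P :: "'a::field poly" and k l :: nat
  assumes "k < l"
    and "\<And>i. k < i \<Longrightarrow> i < l \<Longrightarrow> Polynomial.coeff P i = 0"
  shows "Polynomial.monom 1 l dvd P
    \<or> Polynomial.degree P \<le> k
    \<or> (\<exists>q \<in> char_powers CHAR('a). N q P \<ge> int l - int k)"
proof (cases "poly_cutoff l P = 0 \<or> poly_shift l P = 0")
  case True
  then show ?thesis
  proof
    assume cutoff: "poly_cutoff l P = 0"
    have low: "Polynomial.coeff P i = 0" if "i < l" for i
      using arg_cong[OF cutoff, of "\<lambda>r. Polynomial.coeff r i"] that
      by (simp add: coeff_poly_cutoff)
    have "P = Polynomial.monom 1 l * poly_shift l P"
      by (rule poly_eqI) (simp add: low coeff_monom_mult coeff_poly_shift)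
    then show ?thesis by (metis dvd_triv_left)
  next
    assume shift: "poly_shift l P = 0"
    have "Polynomial.coeff P i = 0" if "k < i" for i
    proof (cases "i < l")
      case False
      then show ?thesis
        using arg_cong[OF shift, of "\<lambda>r. Polynomial.coeff r (i - l)"]
        by (simp add: coeff_poly_shift)
    qed (use that assms(2) in auto)
    then show ?thesis
      using Polynomial.degree_le by blast
  qed
next
  case False
  let ?E = "map_poly to_ac :: 'a poly \<Rightarrow> 'a alg_closure poly"
  define A where "A = ?E (poly_cutoff l P)"
  define B where "B = Polynomial.monom 1 l * ?E (poly_shift l P)"
  have nz: "A \<noteq> 0" "B \<noteq> 0"
    using False by (auto simp: A_def B_def map_poly_eq_0_iff monom_eq_0_iff)
  have P_eq: "?E P = A + B"
    by (rule poly_eqI)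
       (simp add: A_def B_def coeff_map_poly coeff_poly_cutoff coeff_monom_mult coeff_poly_shift)
  have degA: "Polynomial.degree A \<le> k"
    by (rule Polynomial.degree_le)
       (use assms(2) in \<open>auto simp: A_def coeff_map_poly coeff_poly_cutoff\<close>)
  have ordB: "l \<le> Polynomial.order 0 B"
    using nz(2) by (simp add: monom_1_dvd_iff[symmetric] B_def)

  obtain C F G where CFG: "A = C * F" "B = C * G" "coprime F G"
    using gcd_coprime_exists[of A B] nz by (metis gcd_eq_0_iff mult.commute)
  have nz': "C \<noteq> 0" "F \<noteq> 0" "G \<noteq> 0"
    using CFG nz by auto
  have degF: "Polynomial.degree C + Polynomial.degree F \<le> k"
    using degA nz' by (simp add: CFG degree_mult_eq)
  have ordG: "l \<le> Polynomial.order 0 C + Polynomial.order 0 G"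
    using ordB nz' by (simp add: CFG order_mult)
  have ordC: "Polynomial.order 0 C \<le> Polynomial.degree C"
    using nz'(1) by (rule order_degree)
  \<comment> \<open>Removing \<open>C\<close> costs \<open>degree C\<close> in the degree of \<open>A\<close> but only \<open>order 0 C \<le> degree C\<close> in the order
     of \<open>B\<close>, so the order of \<open>G\<close> at \<open>0\<close> still exceeds the degree of \<open>F\<close>.\<close>
  have "Polynomial.order 0 G > 0"
    using assms(1) degF ordG ordC by linarith
  then have "Polynomial.degree G > 0"
    using order_degree[OF nz'(3), of 0] by linarith
  then obtain q F1 G1 where q: "q \<in> char_powers CHAR('a)" "F = F1 ^ q" "G = G1 ^ q"
      and W: "F1 * pderiv G1 - pderiv F1 * G1 \<noteq> 0"
    using coprime_pair_as_powers[OF CFG(3)] by auto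
  have "q > 0"
    using q(1) by (rule char_powers_pos)
  have nz1: "F1 \<noteq> 0" "G1 \<noteq> 0"
    using W by auto
  have degF1: "Polynomial.degree F = q * Polynomial.degree F1"
    using nz1 by (simp add: q degree_power_eq)
  have ordG1: "Polynomial.order 0 G = q * Polynomial.order 0 G1"
    using nz1 by (simp add: q order_power)
  have "q * Polynomial.degree F1 < q * Polynomial.order 0 G1"
    using degF ordG ordC assms(1) unfolding degF1 ordG1 by linarith
  then have lt: "Polynomial.degree F1 < Polynomial.order 0 G1"
    by simp
  have G10: "poly G1 0 = 0"
    using lt by (simp add: order_root)
  have F10: "poly F1 0 \<noteq> 0"
  proof
    assume "poly F1 0 = 0"
    then have "[:0, 1:] dvd F1" "[:0, 1:] dvd G1"
      using G10 poly_eq_0_iff_dvd[of _ 0] by auto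
    moreover have "coprime F1 G1"
      using CFG(3) \<open>q > 0\<close> unfolding q by simp
    ultimately have "is_unit [:0, 1 :: 'a alg_closure:]"
      using not_coprimeI by blast
    then show False
      by (simp add: is_unit_pCons_iff)
  qed

  define H where "H = F1 + G1"
  have H0: "poly H 0 \<noteq> 0"
    using F10 G10 by (simp add: H_def)
  have "?E P = C * H ^ q"
    using add_power_char_powers[of q F1 G1] q(1)
    by (simp add: P_eq CFG(1,2) q(2,3) H_def distrib_left)
  then have "N q P \<ge> int q * int (card {x. poly H x = 0})
      + int (Polynomial.order 0 C) - int (Polynomial.degree C)"
    using \<open>q > 0\<close> nz'(1) H0 by (intro N_ge_of_power_factor) auto
  moreover have "int l - int k \<le> int q * int (card {x. poly H x = 0})
      + int (Polynomial.order 0 C) - int (Polynomial.degree C)"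
  proof -
    have "Polynomial.order 0 G1 \<le> Polynomial.degree F1 + card {x. poly H x = 0}"
      unfolding H_def using W F10 lt by (rule card_roots_add_ge)
    then have "q * Polynomial.order 0 G1 \<le> q * Polynomial.degree F1 + q * card {x. poly H x = 0}"
      by (metis distrib_left mult_le_mono2)
    then have "int (q * Polynomial.order 0 G1)
        \<le> int (q * Polynomial.degree F1) + int q * int (card {x. poly H x = 0})"
      by (metis of_nat_add of_nat_le_iff of_nat_mult)
    then show ?thesis
      using degF ordG unfolding degF1 ordG1 by linarith
  qed
  ultimately show ?thesis
    using q(1) by force
qed

end
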